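(* Let $n\ge 1$ be an integer, $T>0$ and $\delta\in(0,1)$. Let $\mathcal{D}=\{\bar t=(t_0,\dots,t_n)\in\mathbb{R}^{n+1}: t_0=0,\ t_n=T,\ t_i\le t_{i+1}\text{ for }0\le i\le n-1\}$ and $L(\bar t)=\sum_{0\le j<i\le n}\delta^{t_i-t_j}$. Let $\bar t^*=(t_0^*,\dots,t_n^* )$ be the unique minimizer of $L$ over $\mathcal{D}$. Then there is an algorithm which, given $n,\delta,T$, outputs a schedule $\bar t=(t_0,\dots,t_n)$ with $t_i^*-\frac{1}{2^n}\le t_i\le t_i^*+\frac{1}{2^n}$ for every $i\in\{0,\dots,n\}$.
   Context: Ad-scheduling model: $n+1$ instantaneous ads are shown at times $t_0\le t_1\le\dots\le t_n$ in $[0,T]$; maximizing the total reward for a fixed number of ads is equivalent to minimizing the loss $L(\bar t)=\sum_{0\le j<i\le n}\delta^{t_i-t_j}$ over the feasible set $\mathcal{D}$. *)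

theory Defs
  imports Complex_Main
begin

definition feasible :: "nat \<Rightarrow> real \<Rightarrow> real list set" where
  "feasible n T =
     {t. length t = n + 1 \<and> t ! 0 = 0 \<and> t ! n = T \<and> (\<forall>i<n. t ! i \<le> t ! (i + 1))}"

definition loss :: "nat \<Rightarrow> real \<Rightarrow> real list \<Rightarrow> real" where
  "loss n \<delta> t = (\<Sum>(j, i) \<in> {(j, i). j < i \<and> i \<le> n}. \<delta> powr (t ! i - t ! j))"

definition optimal_schedule :: "nat \<Rightarrow> real \<Rightarrow> real \<Rightarrow> real list" where
  "optimal_schedule n \<delta> T = (THE t. is_arg_min (loss n \<delta>) (\<lambda>t. t \<in> feasible n T) t)"

text \<open>
  Algorithms on real inputs are programs of a real random access machine: structured programs
  over one memory of natural numbers (counters and addresses) and one memory of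
  real numbers, both with indirect addressing. The only exact operations on reals are the
  field operations, the order test and the embedding of naturals; there are no rounding and
  no transcendental primitives, and all program constants are natural numbers, so a program
  is a finite object that cannot encode real-valued advice.
\<close>

datatype nexp =
    NConst nat
  | NLoad nexp
  | NAdd nexp nexp
  | NSub nexp nexp
  | NMult nexp nexp
  | NDiv nexp nexp
  | NMod nexp nexp

datatype rexp =
    ROfNat nexp
  | RLoad nexp
  | RAdd rexp rexp
  | RSub rexp rexp
  | RMult rexp rexp
  | RDiv rexp rexp

datatype bexp =
    NLess nexp nexp
  | RLess rexp rexp
  | BNot bexp
  | BAnd bexp bexp

datatype com =
    Skip
  | NStore nexp nexp
  | RStore nexp rexp
  | Seq com com
  | Cond bexp com com
  | While bexp com

record state =
  nmem :: "nat \<Rightarrow> nat"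
  rmem :: "nat \<Rightarrow> real"

primrec nval :: "nexp \<Rightarrow> state \<Rightarrow> nat" where
  "nval (NConst c) s = c"
| "nval (NLoad a) s = nmem s (nval a s)"
| "nval (NAdd a b) s = nval a s + nval b s"
| "nval (NSub a b) s = nval a s - nval b s"
| "nval (NMult a b) s = nval a s * nval b s"
| "nval (NDiv a b) s = nval a s div nval b s"
| "nval (NMod a b) s = nval a s mod nval b s"

primrec rval :: "rexp \<Rightarrow> state \<Rightarrow> real" where
  "rval (ROfNat a) s = real (nval a s)"
| "rval (RLoad a) s = rmem s (nval a s)"
| "rval (RAdd a b) s = rval a s + rval b s"
| "rval (RSub a b) s = rval a s - rval b s"
| "rval (RMult a b) s = rval a s * rval b s"
| "rval (RDiv a b) s = rval a s / rval b s"

primrec bval :: "bexp \<Rightarrow> state \<Rightarrow> bool" where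
  "bval (NLess a b) s \<longleftrightarrow> nval a s < nval b s"
| "bval (RLess a b) s \<longleftrightarrow> rval a s < rval b s"
| "bval (BNot b) s \<longleftrightarrow> \<not> bval b s"
| "bval (BAnd b c) s \<longleftrightarrow> bval b s \<and> bval c s"

text \<open>\<open>exec c s s'\<close>: started in \<open>s\<close>, the program \<open>c\<close> terminates in \<open>s'\<close>.\<close>

inductive exec :: "com \<Rightarrow> state \<Rightarrow> state \<Rightarrow> bool" where
  Skip: "exec Skip s s"
| NStore: "exec (NStore a e) s (s\<lparr>nmem := (nmem s)(nval a s := nval e s)\<rparr>)"
| RStore: "exec (RStore a e) s (s\<lparr>rmem := (rmem s)(nval a s := rval e s)\<rparr>)"
| Seq: "exec c s s' \<Longrightarrow> exec d s' s'' \<Longrightarrow> exec (Seq c d) s s''"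
| CondTrue: "bval b s \<Longrightarrow> exec c s s' \<Longrightarrow> exec (Cond b c d) s s'"
| CondFalse: "\<not> bval b s \<Longrightarrow> exec d s s' \<Longrightarrow> exec (Cond b c d) s s'"
| WhileFalse: "\<not> bval b s \<Longrightarrow> exec (While b c) s s"
| WhileTrue: "bval b s \<Longrightarrow> exec c s s' \<Longrightarrow> exec (While b c) s' s'' \<Longrightarrow> exec (While b c) s s''"

inductive_cases SkipE: "exec Skip s s'"
inductive_cases NStoreE: "exec (NStore a e) s s'"
inductive_cases RStoreE: "exec (RStore a e) s s'"
inductive_cases SeqE: "exec (Seq c d) s s'"
inductive_cases CondE: "exec (Cond b c d) s s'"
inductive_cases WhileE: "exec (While b c) s s'"

lemma exec_deterministic: "exec c s s' \<Longrightarrow> exec c s s'' \<Longrightarrow> s'' = s'"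
proof (induction arbitrary: s'' rule: exec.induct)
  case Skip then show ?case by (auto elim: SkipE)
next
  case NStore then show ?case by (auto elim: NStoreE)
next
  case RStore then show ?case by (auto elim: RStoreE)
next
  case (Seq c s s1 d s2) then show ?case by (metis SeqE)
next
  case (CondTrue b s c s1 d) then show ?case by (metis CondE)
next
  case (CondFalse b s d s1 c) then show ?case by (metis CondE)
next
  case (WhileFalse b s c) then show ?case by (metis WhileE)
next
  case (WhileTrue b s c s1 s2) then show ?case by (metis WhileE)
qed

definition initial_state :: "nat \<Rightarrow> real \<Rightarrow> real \<Rightarrow> state" where
  "initial_state n \<delta> T =
     \<lparr>nmem = (\<lambda>_. 0)(0 := n), rmem = (\<lambda>_. 0)(0 := \<delta>, 1 := T)\<rparr>"

text \<open>The output \<open>(t\<^sub>0, \<dots>, t\<^sub>n)\<close> is read off the real cells \<open>0, \<dots>, n\<close> after termination.\<close>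

definition outputs :: "com \<Rightarrow> nat \<Rightarrow> real \<Rightarrow> real \<Rightarrow> real list \<Rightarrow> bool" where
  "outputs P n \<delta> T t \<longleftrightarrow>
     (\<exists>s. exec P (initial_state n \<delta> T) s \<and> t = map (rmem s) [0..<n + 1])"

end

theory Submission imports Defs begin

text \<open>
  At an interior point of a minimizer the discounted sums over the earlier and over the later
  points agree, and comparing neighbouring points shows that all of them equal one number \<open>z\<close>.
  Points at \<open>0\<close> and \<open>T\<close> may coincide; with that taken into account, \<open>\<delta>\<close> raised to the
  \<open>i\<close>-th gap is \<open>min 1 (z / min (min i (n + 1 - i)) (z + 1))\<close>. Conversely each of these schedules
  satisfies the optimality conditions for its own total length, hence is the strict minimizer by
  convexity, and by continuity every length \<open>T\<close> occurs.

  Every gap decreases in \<open>z\<close>, so a schedule of total length within \<open>\<epsilon>\<close> of \<open>T\<close> is within \<open>\<epsilon>\<close> of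
  the optimum at every point. The program decreases \<open>z\<close> geometrically from \<open>n\<close>, by a factor \<open>\<rho>\<close> with
  \<open>\<rho> ^ (n * M) \<ge> \<delta>\<close> where \<open>M = 2 ^ (n + 1)\<close>, so that the total length grows by at most \<open>1 / M\<close>
  per step, until it reaches \<open>T\<close>. A time \<open>x = log \<delta> a\<close> is rounded down to a multiple of \<open>1 / M\<close> by
  field operations only, because \<open>p \<le> M * x < p + 1\<close> means \<open>\<delta> ^ (p + 1) < a ^ M \<le> \<delta> ^ p\<close>.
\<close>

definition gap_ratio :: "nat \<Rightarrow> real \<Rightarrow> nat \<Rightarrow> real" where
  "gap_ratio n z i = min 1 (z / min (real (min i (n + 1 - i))) (z + 1))"

definition sched :: "real \<Rightarrow> nat \<Rightarrow> real \<Rightarrow> nat \<Rightarrow> real" where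
  "sched \<delta> n z i = (\<Sum>l=1..i. log \<delta> (gap_ratio n z l))"

lemma sched_0 [simp]: "sched \<delta> n z 0 = 0"
  by (simp add: sched_def)

lemma sched_Suc: "sched \<delta> n z (Suc i) = sched \<delta> n z i + log \<delta> (gap_ratio n z (Suc i))"
  by (simp add: sched_def)

lemma gap_ratio_le_1: "gap_ratio n z i \<le> 1"
  by (simp add: gap_ratio_def)

lemma gap_ratio_pos:
  assumes "z > 0" "1 \<le> i" "i \<le> n"
  shows "gap_ratio n z i > 0"
proof -
  have "min i (n + 1 - i) > 0" using assms by auto
  then have "min (real (min i (n + 1 - i))) (z + 1) > 0" using assms by (simp del: of_nat_min)
  then show ?thesis using assms by (simp add: gap_ratio_def)
qed

lemma gap_ratio_eq_1:
  assumes "z > 0" "1 \<le> i" "i \<le> n" "real (min i (n + 1 - i)) \<le> z"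
  shows "gap_ratio n z i = 1"
proof -
  have "real (min i (n + 1 - i)) > 0" using assms by auto
  then show ?thesis using assms by (simp add: gap_ratio_def del: of_nat_min)
qed

lemma gap_ratio_max:
  assumes "z > 0" "1 \<le> i" "i \<le> n"
  shows "gap_ratio n z i = min 1 (max (z / real (min i (n + 1 - i))) (z / (z + 1)))"
proof -
  define e where "e = real (min i (n + 1 - i))"
  have e: "e > 0" using assms by (auto simp: e_def)
  have "z / min e (z + 1) = max (z / e) (z / (z + 1))"
  proof (cases "e \<le> z + 1")
    case True
    then have "z / (z + 1) \<le> z / e" using e assms by (intro divide_left_mono) auto
    then show ?thesis using True by simp
  next
    case False
    then have "z / e \<le> z / (z + 1)" using e assms by (intro divide_left_mono) auto
    then show ?thesis using False by simp
  qed
  then show ?thesis by (simp add: gap_ratio_def e_def)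
qed

lemma gap_ratio_mono:
  assumes "0 < z" "z \<le> z'" "1 \<le> i" "i \<le> n"
  shows "gap_ratio n z i \<le> gap_ratio n z' i"
proof -
  have "z / (z + 1) \<le> z' / (z' + 1)" using assms by (simp add: field_simps)
  moreover have "z / real (min i (n + 1 - i)) \<le> z' / real (min i (n + 1 - i))"
    using assms by (intro divide_right_mono) auto
  ultimately show ?thesis using assms
    by (simp add: gap_ratio_max del: of_nat_min) linarith
qed

lemma gap_ratio_scale:
  assumes "0 < z" "0 < r" "r \<le> 1" "1 \<le> i" "i \<le> n"
  shows "r * gap_ratio n z i \<le> gap_ratio n (r * z) i"
proof -
  define e where "e = real (min i (n + 1 - i))"
  have e: "e > 0" using assms by (auto simp: e_def)
  have rz: "0 < r * z" "r * z \<le> z" using assms by (auto simp: mult_le_cancel_right1)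
  have "r * (z / min e (z + 1)) \<le> r * z / min e (r * z + 1)"
    unfolding times_divide_eq_right
  proof (rule divide_left_mono)
    show "min e (r * z + 1) \<le> min e (z + 1)" using rz by (intro min.mono) auto
    show "0 < min e (z + 1) * min e (r * z + 1)"
      using e rz assms(1) by (intro mult_pos_pos) (auto simp: add_pos_pos)
  qed (use rz in auto)
  then have "min r (r * (z / min e (z + 1))) \<le> min 1 (r * z / min e (r * z + 1))"
    using assms by linarith
  moreover have "r * min 1 (z / min e (z + 1)) = min r (r * (z / min e (z + 1)))"
    using assms min_mult_distrib_left[of r 1 "z / min e (z + 1)"] by simp
  ultimately show ?thesis unfolding gap_ratio_def e_def by linarith
qed

lemma gap_ratio_last_le: "z > 0 \<Longrightarrow> n \<ge> 1 \<Longrightarrow> gap_ratio n z n \<le> z"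
  by (simp add: gap_ratio_def)

lemma log_base_less_1:
  assumes "0 < \<delta>" "\<delta> < (1::real)" "0 < a" "a \<le> b"
  shows "log \<delta> b \<le> log \<delta> a"
  using assms by (simp add: log_def divide_right_mono_neg)

lemma log_gap_ratio_nonneg:
  assumes "0 < \<delta>" "\<delta> < 1" "z > 0" "1 \<le> i" "i \<le> n"
  shows "0 \<le> log \<delta> (gap_ratio n z i)"
  using log_base_less_1[OF assms(1,2) gap_ratio_pos gap_ratio_le_1] assms by auto

lemma sched_mono:
  assumes "0 < \<delta>" "\<delta> < 1" "z > 0" "i \<le> j" "j \<le> n"
  shows "sched \<delta> n z i \<le> sched \<delta> n z j"
  unfolding sched_def using assms by (intro sum_mono2 log_gap_ratio_nonneg) auto

lemma sched_nonneg:
  assumes "0 < \<delta>" "\<delta> < 1" "z > 0" "i \<le> n"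
  shows "0 \<le> sched \<delta> n z i"
  using sched_mono[of \<delta> z 0 i n] assms by simp

lemma sched_diff_bounds:
  assumes "0 < \<delta>" "\<delta> < 1" "0 < z" "z \<le> z'" "i \<le> n"
  shows "0 \<le> sched \<delta> n z i - sched \<delta> n z' i"
    and "sched \<delta> n z i - sched \<delta> n z' i \<le> sched \<delta> n z n - sched \<delta> n z' n"
proof -
  have *: "0 \<le> log \<delta> (gap_ratio n z l) - log \<delta> (gap_ratio n z' l)" if "1 \<le> l" "l \<le> n" for l
    using log_base_less_1[OF assms(1,2) gap_ratio_pos gap_ratio_mono] assms that by auto
  show "0 \<le> sched \<delta> n z i - sched \<delta> n z' i"
    unfolding sched_def sum_subtractf[symmetric] using assms * by (intro sum_nonneg) auto
  show "sched \<delta> n z i - sched \<delta> n z' i \<le> sched \<delta> n z n - sched \<delta> n z' n"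
    unfolding sched_def sum_subtractf[symmetric] using assms * by (intro sum_mono2) auto
qed

lemma sched_scale:
  assumes "0 < \<delta>" "\<delta> < 1" "0 < z" "0 < r" "r \<le> 1"
  shows "sched \<delta> n (r * z) n \<le> sched \<delta> n z n + real n * log \<delta> r"
proof -
  have "log \<delta> (gap_ratio n (r * z) l) \<le> log \<delta> (gap_ratio n z l) + log \<delta> r"
    if l: "1 \<le> l" "l \<le> n" for l
  proof -
    have pos: "gap_ratio n z l > 0" using gap_ratio_pos assms l by auto
    have "log \<delta> (gap_ratio n (r * z) l) \<le> log \<delta> (r * gap_ratio n z l)"
      using log_base_less_1[OF assms(1,2) _ gap_ratio_scale] assms l pos by auto
    also have "\<dots> = log \<delta> (gap_ratio n z l) + log \<delta> r"
      using assms pos by (simp add: log_mult)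
    finally show ?thesis .
  qed
  then have "sched \<delta> n (r * z) n \<le> (\<Sum>l=1..n. log \<delta> (gap_ratio n z l) + log \<delta> r)"
    unfolding sched_def by (intro sum_mono) auto
  then show ?thesis by (simp add: sched_def sum.distrib)
qed

lemma sched_last_ge:
  assumes "0 < \<delta>" "\<delta> < 1" "0 < z" "n \<ge> 1" "z \<le> \<delta> powr S"
  shows "S \<le> sched \<delta> n z n"
proof -
  have "gap_ratio n z n \<le> \<delta> powr S" using gap_ratio_last_le[of z n] assms by simp
  then have "log \<delta> (\<delta> powr S) \<le> log \<delta> (gap_ratio n z n)"
    using assms gap_ratio_pos by (intro log_base_less_1) auto
  then have "S \<le> log \<delta> (gap_ratio n z n)" using assms by simp
  moreover obtain m where "n = Suc m" using assms by (cases n) auto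
  ultimately show ?thesis using sched_nonneg[of \<delta> z m n] assms by (simp add: sched_Suc)
qed

lemma sched_eq_0:
  assumes "z > 0" "i \<le> n" "\<And>l. 1 \<le> l \<Longrightarrow> l \<le> i \<Longrightarrow> real (min l (n + 1 - l)) \<le> z"
  shows "sched \<delta> n z i = 0"
  unfolding sched_def
proof (intro sum.neutral ballI)
  fix l assume "l \<in> {1..i}"
  then show "log \<delta> (gap_ratio n z l) = 0"
    using assms gap_ratio_eq_1[of z l n] by simp
qed

lemma continuous_on_sched:
  assumes "0 < \<delta>" "\<delta> < 1" "0 < a"
  shows "continuous_on {a..b} (\<lambda>z. sched \<delta> n z n)"
proof -
  have "continuous_on {a..b} (\<lambda>z. gap_ratio n z l)" if "1 \<le> l" "l \<le> n" for l
  proof -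
    define e where "e = real (min l (n + 1 - l))"
    have e: "e > 0" using that by (auto simp: e_def)
    have "min e (z + 1) \<noteq> 0" if "z \<in> {a..b}" for z using e that assms by auto
    then show ?thesis unfolding gap_ratio_def e_def[symmetric]
      by (intro continuous_intros) auto
  qed
  moreover have "gap_ratio n z l \<noteq> 0" if "1 \<le> l" "l \<le> n" "z \<in> {a..b}" for l z
    using gap_ratio_pos[of z l n] that assms by auto
  ultimately show ?thesis unfolding sched_def log_def using assms
    by (intro continuous_intros) auto
qed

lemma sched_surj:
  assumes "0 < \<delta>" "\<delta> < 1" "T > 0" "n \<ge> 1"
  obtains z where "0 < z" "z \<le> real ((n + 1) div 2)" "sched \<delta> n z n = T"
proof -
  define a b where "a = \<delta> powr T" and "b = real ((n + 1) div 2)"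
  have a: "0 < a" "a \<le> 1" using assms powr_le1[of T \<delta>] by (auto simp: a_def)
  have "(n + 1) div 2 \<ge> 1" using assms by linarith
  then have ab: "a \<le> b" using a by (simp add: b_def)
  have "sched \<delta> n b n = 0"
  proof (rule sched_eq_0)
    show "real (min l (n + 1 - l)) \<le> b" for l
      unfolding b_def of_nat_le_iff by linarith
  qed (use a ab in auto)
  moreover have "T \<le> sched \<delta> n a n" using assms a by (intro sched_last_ge) (auto simp: a_def)
  ultimately have "\<exists>z\<ge>a. z \<le> b \<and> sched \<delta> n z n = T"
    using assms ab a continuous_on_sched[of \<delta> a b n] by (intro IVT2') auto
  then obtain z where "a \<le> z" "z \<le> b" "sched \<delta> n z n = T" by blast
  then show ?thesis using that[of z] a by (simp add: b_def)
qed

definition left_sum :: "real \<Rightarrow> (nat \<Rightarrow> real) \<Rightarrow> nat \<Rightarrow> real" where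
  "left_sum \<delta> t i = (\<Sum>j<i. \<delta> powr (t i - t j))"

definition right_sum :: "nat \<Rightarrow> real \<Rightarrow> (nat \<Rightarrow> real) \<Rightarrow> nat \<Rightarrow> real" where
  "right_sum n \<delta> t i = (\<Sum>k\<in>{i<..n}. \<delta> powr (t k - t i))"

lemma left_sum_Suc:
  assumes "\<delta> > 0"
  shows "left_sum \<delta> t (Suc i) = (left_sum \<delta> t i + 1) * \<delta> powr (t (Suc i) - t i)"
proof -
  have "\<delta> powr (t (Suc i) - t j) = \<delta> powr (t i - t j) * \<delta> powr (t (Suc i) - t i)" for j
    by (simp add: powr_add[symmetric])
  then have "left_sum \<delta> t (Suc i) = (\<Sum>j<Suc i. \<delta> powr (t i - t j) * \<delta> powr (t (Suc i) - t i))"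
    unfolding left_sum_def by (intro sum.cong refl)
  also have "\<dots> = (\<Sum>j<Suc i. \<delta> powr (t i - t j)) * \<delta> powr (t (Suc i) - t i)"
    by (rule sum_distrib_right[symmetric])
  finally show ?thesis using assms by (simp add: left_sum_def)
qed

lemma right_sum_step:
  assumes "\<delta> > 0" "i < n"
  shows "right_sum n \<delta> t i = (right_sum n \<delta> t (Suc i) + 1) * \<delta> powr (t (Suc i) - t i)"
proof -
  have "\<delta> powr (t k - t i) = \<delta> powr (t k - t (Suc i)) * \<delta> powr (t (Suc i) - t i)" for k
    by (simp add: powr_add[symmetric])
  then have "right_sum n \<delta> t i
      = (\<Sum>k\<in>{i<..n}. \<delta> powr (t k - t (Suc i)) * \<delta> powr (t (Suc i) - t i))"
    unfolding right_sum_def by (intro sum.cong refl)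
  also have "\<dots> = (\<Sum>k\<in>{i<..n}. \<delta> powr (t k - t (Suc i))) * \<delta> powr (t (Suc i) - t i)"
    by (rule sum_distrib_right[symmetric])
  also have "{i<..n} = insert (Suc i) {Suc i<..n}" using assms by auto
  finally show ?thesis using assms by (simp add: right_sum_def)
qed

lemma gap_ratio_step:
  assumes "0 < z" "1 \<le> i" "i \<le> n" "real (min i (n + 1 - i)) \<le> w"
  shows "min w z \<le> min w (z + 1) * gap_ratio n z i"
    and "w = real (min i (n + 1 - i)) \<or> (z + 1 \<le> w \<and> z + 1 \<le> real (min i (n + 1 - i)))
      \<Longrightarrow> min w (z + 1) * gap_ratio n z i = min w z"
proof -
  define e where "e = real (min i (n + 1 - i))"
  have e: "e > 0" "e \<le> w" using assms by (auto simp: e_def)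
  have g: "gap_ratio n z i = min 1 (z / min e (z + 1))" by (simp add: gap_ratio_def e_def)
  have pos: "0 < min e (z + 1)" "min e (z + 1) \<le> min w (z + 1)" using e assms by auto
  have "z \<le> min w (z + 1) * (z / min e (z + 1))"
    using pos assms by (simp add: field_simps)
  moreover have "min w (z + 1) * gap_ratio n z i
      = min (min w (z + 1)) (min w (z + 1) * (z / min e (z + 1)))"
    unfolding g using pos e min_mult_distrib_left[of "min w (z + 1)" 1] by simp
  ultimately show "min w z \<le> min w (z + 1) * gap_ratio n z i" by linarith
  assume "w = real (min i (n + 1 - i)) \<or> (z + 1 \<le> w \<and> z + 1 \<le> real (min i (n + 1 - i)))"
  then have eq: "min w (z + 1) = min e (z + 1)" unfolding e_def[symmetric] by auto
  have "min e (z + 1) * min 1 (z / min e (z + 1)) = min (min e (z + 1)) z"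
    using pos(1) min_mult_distrib_left[of "min e (z + 1)" 1 "z / min e (z + 1)"]
    by (simp add: less_imp_le less_imp_neq[OF pos(1), symmetric])
  then have "min w (z + 1) * gap_ratio n z i = min (min w (z + 1)) z"
    unfolding g eq .
  then show "min w (z + 1) * gap_ratio n z i = min w z" using assms by linarith
qed

context
  fixes \<delta> z :: real and n :: nat
  assumes \<delta>: "0 < \<delta>" "\<delta> < 1" and z: "0 < z"
begin

lemma powr_sched_step:
  assumes "i < n"
  shows "\<delta> powr (sched \<delta> n z (Suc i) - sched \<delta> n z i) = gap_ratio n z (Suc i)"
  using \<delta> gap_ratio_pos[OF z, of "Suc i" n] assms by (simp add: sched_Suc)

lemma left_sum_sched:
  assumes "i \<le> n"
  shows "min (real i) z \<le> left_sum \<delta> (sched \<delta> n z) i \<and>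
    (z \<le> real (n - i) \<longrightarrow> left_sum \<delta> (sched \<delta> n z) i = min (real i) z)"
  using assms
proof (induction i)
  case 0
  then show ?case using z by (simp add: left_sum_def)
next
  case (Suc i)
  let ?x = "left_sum \<delta> (sched \<delta> n z)" and ?g = "gap_ratio n z (Suc i)"
  have x: "?x (Suc i) = (?x i + 1) * ?g"
    using left_sum_Suc[OF \<delta>(1)] powr_sched_step[of i] Suc.prems by simp
  have g: "?g > 0" using gap_ratio_pos z Suc.prems by simp
  have "min (real (Suc i)) z \<le> min (real (Suc i)) (z + 1) * ?g"
    using z Suc.prems by (intro gap_ratio_step) auto
  also have "\<dots> \<le> (?x i + 1) * ?g" using Suc g by (intro mult_right_mono) auto
  finally have 1: "min (real (Suc i)) z \<le> ?x (Suc i)" using x by simp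
  have 2: "?x (Suc i) = min (real (Suc i)) z" if *: "z \<le> real (n - Suc i)"
  proof -
    have "?x i = min (real i) z" using Suc that by auto
    then have "?x i + 1 = min (real (Suc i)) (z + 1)" by (simp add: min_def)
    then have "?x (Suc i) = min (real (Suc i)) (z + 1) * ?g" using x by simp
    also have "\<dots> = min (real (Suc i)) z"
      using z Suc.prems * by (intro gap_ratio_step) (auto simp: min_def of_nat_diff)
    finally show ?thesis .
  qed
  from 1 2 show ?case by blast
qed

lemma right_sum_sched:
  assumes "i \<le> n"
  shows "min (real (n - i)) z \<le> right_sum n \<delta> (sched \<delta> n z) i \<and>
    (z \<le> real i \<longrightarrow> right_sum n \<delta> (sched \<delta> n z) i = min (real (n - i)) z)"
  using assms
proof (induction i rule: inc_induct)
  case base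
  then show ?case using z by (simp add: right_sum_def)
next
  case (step i)
  let ?y = "right_sum n \<delta> (sched \<delta> n z)" and ?g = "gap_ratio n z (Suc i)"
  have y: "?y i = (?y (Suc i) + 1) * ?g"
    using right_sum_step[OF \<delta>(1)] powr_sched_step[of i] step.hyps by simp
  have g: "?g > 0" using gap_ratio_pos z step.hyps by simp
  have ni: "real (n - i) = real (n - Suc i) + 1" using step.hyps by (simp add: of_nat_diff)
  have "min (real (n - i)) z \<le> min (real (n - i)) (z + 1) * ?g"
    using z step.hyps by (intro gap_ratio_step) auto
  also have "\<dots> \<le> (?y (Suc i) + 1) * ?g"
    using step.IH g ni by (intro mult_right_mono) auto
  finally have 1: "min (real (n - i)) z \<le> ?y i" using y by simp
  have 2: "?y i = min (real (n - i)) z" if *: "z \<le> real i"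
  proof -
    have "?y (Suc i) = min (real (n - Suc i)) z" using step.IH that by auto
    then have "?y (Suc i) + 1 = min (real (n - i)) (z + 1)" using ni by (simp add: min_def)
    then have "?y i = min (real (n - i)) (z + 1) * ?g" using y by simp
    also have "\<dots> = min (real (n - i)) z"
      using z step.hyps * by (intro gap_ratio_step) (auto simp: min_def of_nat_diff)
    finally show ?thesis .
  qed
  from 1 2 show ?case by blast
qed

end

lemma sum_pairs_eq:
  fixes d :: "nat \<Rightarrow> real"
  shows "(\<Sum>(j, i) \<in> {(j, i). j < i \<and> i \<le> n}. \<delta> powr (t i - t j) * (d i - d j))
    = (\<Sum>i\<le>n. d i * (left_sum \<delta> t i - right_sum n \<delta> t i))"
proof -
  let ?S = "{(j, i). j < i \<and> i \<le> n}"
  have S1: "?S = Sigma {..n} (\<lambda>j. {j<..n})" by auto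
  have S2: "?S = prod.swap ` Sigma {..n} (\<lambda>i. {..<i})" by (auto simp: image_iff)
  have "(\<Sum>(j, i) \<in> ?S. \<delta> powr (t i - t j) * d i) = (\<Sum>(i, j) \<in> Sigma {..n} (\<lambda>i. {..<i}). \<delta> powr (t i - t j) * d i)"
    unfolding S2 by (subst sum.reindex) (auto intro!: sum.cong)
  also have "\<dots> = (\<Sum>i\<le>n. d i * left_sum \<delta> t i)"
    by (subst sum.Sigma[symmetric]) (auto simp: left_sum_def sum_distrib_left mult.commute)
  finally have 1: "(\<Sum>(j, i) \<in> ?S. \<delta> powr (t i - t j) * d i) = (\<Sum>i\<le>n. d i * left_sum \<delta> t i)" .
  have 2: "(\<Sum>(j, i) \<in> ?S. \<delta> powr (t i - t j) * d j) = (\<Sum>j\<le>n. d j * right_sum n \<delta> t j)"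
    unfolding S1
    by (subst sum.Sigma[symmetric]) (auto simp: right_sum_def sum_distrib_left mult.commute)
  have "(\<Sum>(j, i) \<in> ?S. \<delta> powr (t i - t j) * (d i - d j))
    = (\<Sum>(j, i) \<in> ?S. \<delta> powr (t i - t j) * d i) - (\<Sum>(j, i) \<in> ?S. \<delta> powr (t i - t j) * d j)"
    by (simp add: sum_subtractf[symmetric] right_diff_distrib case_prod_unfold)
  then show ?thesis using 1 2 by (simp add: sum_subtractf[symmetric] right_diff_distrib)
qed

lemma one_plus_less_exp:
  assumes "x \<noteq> 0"
  shows "1 + x < exp (x::real)"
proof -
  have "exp x \<noteq> 1 + x"
  proof
    assume "exp x = 1 + x"
    then have "ln (exp x) = exp x - 1" unfolding ln_exp by simp
    then have "exp x = 1" by (rule ln_eq_minus_one[OF exp_gt_zero])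
    then show False using assms by simp
  qed
  then show ?thesis using exp_ge_add_one_self[of x] by linarith
qed

lemma powr_tangent:
  fixes \<delta> u v :: real
  assumes "\<delta> > 0" "\<delta> \<noteq> 1"
  shows "\<delta> powr u + ln \<delta> * (\<delta> powr u * (v - u)) \<le> \<delta> powr v"
    and "u \<noteq> v \<Longrightarrow> \<delta> powr u + ln \<delta> * (\<delta> powr u * (v - u)) < \<delta> powr v"
proof -
  have v: "\<delta> powr v = \<delta> powr u * exp (ln \<delta> * (v - u))"
    using assms by (simp add: powr_def exp_add[symmetric] algebra_simps)
  have p: "\<delta> powr u > 0" using assms by simp
  have eq: "\<delta> powr u + ln \<delta> * (\<delta> powr u * (v - u)) = \<delta> powr u * (1 + ln \<delta> * (v - u))"
    by (simp add: algebra_simps)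
  show "\<delta> powr u + ln \<delta> * (\<delta> powr u * (v - u)) \<le> \<delta> powr v"
    unfolding v eq using p exp_ge_add_one_self by (intro mult_left_mono) auto
  assume "u \<noteq> v"
  then have "ln \<delta> * (v - u) \<noteq> 0" using assms by simp
  then show "\<delta> powr u + ln \<delta> * (\<delta> powr u * (v - u)) < \<delta> powr v"
    unfolding v eq using p one_plus_less_exp by (intro mult_strict_left_mono) auto
qed

lemma feasible_bounds:
  assumes "t \<in> feasible n T" "i \<le> n"
  shows "0 \<le> t ! i" "t ! i \<le> T"
proof -
  have step: "\<And>k. k < n \<Longrightarrow> t ! k \<le> t ! Suc k" and ends: "t ! 0 = 0" "t ! n = T"
    using assms by (auto simp: feasible_def)
  show "0 \<le> t ! i" using \<open>i \<le> n\<close>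
  proof (induction i)
    case (Suc i) then show ?case using step[of i] by simp
  qed (simp add: ends)
  show "t ! i \<le> T" using \<open>i \<le> n\<close>
  proof (induction i rule: inc_induct)
    case (step i) then show ?case using \<open>\<And>k. k < n \<Longrightarrow> t ! k \<le> t ! Suc k\<close>[of i] by simp
  qed (simp add: ends)
qed

lemma sched_stationary:
  assumes \<delta>: "0 < \<delta>" "\<delta> < 1"
    and z: "0 < z" "z \<le> real ((n + 1) div 2)" and T: "sched \<delta> n z n = T"
    and t: "t \<in> feasible n T" and i: "i \<le> n"
  shows "(t ! i - sched \<delta> n z i) *
    (left_sum \<delta> (sched \<delta> n z) i - right_sum n \<delta> (sched \<delta> n z) i) \<le> 0"
proof -
  note x = left_sum_sched[OF \<delta> z(1) i] and y = right_sum_sched[OF \<delta> z(1) i]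
  consider "real i < z" | "real (n - i) < z" | "z \<le> real i" "z \<le> real (n - i)" by linarith
  then show ?thesis
  proof cases
    case 1
    then have "i < (n + 1) div 2" using z by linarith
    then have "(n + 1) div 2 \<le> n - i" by linarith
    then have "z \<le> real (n - i)" using z by linarith
    moreover have "sched \<delta> n z i = 0" using 1 z i by (intro sched_eq_0) auto
    ultimately show ?thesis using 1 x y feasible_bounds[OF t i]
      by (intro mult_nonneg_nonpos) auto
  next
    case 2
    then have "n - i < (n + 1) div 2" using z by linarith
    then have "(n + 1) div 2 \<le> i" by linarith
    then have zi: "z \<le> real i" using z by linarith
    have "sched \<delta> n z n = sched \<delta> n z i + (\<Sum>l=i+1..n. log \<delta> (gap_ratio n z l))"
      using i sum.ub_add_nat[of 1 i "\<lambda>l. log \<delta> (gap_ratio n z l)" "n - i"]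
      by (simp add: sched_def)
    also have "(\<Sum>l=i+1..n. log \<delta> (gap_ratio n z l)) = 0"
    proof (intro sum.neutral ballI)
      fix l assume l: "l \<in> {i+1..n}"
      then have "real (min l (n + 1 - l)) \<le> z" using 2 by (auto simp: min_def)
      then show "log \<delta> (gap_ratio n z l) = 0" using gap_ratio_eq_1[of z l n] l z by simp
    qed
    finally have "sched \<delta> n z i = T" using T by simp
    then show ?thesis using 2 zi x y feasible_bounds[OF t i]
      by (intro mult_nonpos_nonneg) auto
  next
    case 3
    then show ?thesis using x y by auto
  qed
qed

lemma optimal_schedule_eq_sched:
  assumes \<delta>: "0 < \<delta>" "\<delta> < 1"
    and z: "0 < z" "z \<le> real ((n + 1) div 2)" and T: "sched \<delta> n z n = T"
  shows "optimal_schedule n \<delta> T = map (sched \<delta> n z) [0..<n + 1]"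
proof -
  let ?s = "sched \<delta> n z" and ?S = "{(j, i). j < i \<and> i \<le> n}"
  define s where "s = map ?s [0..<n + 1]"
  have nth: "s ! i = ?s i" if "i \<le> n" for i using that by (simp add: s_def del: upt_Suc)
  have feas: "s \<in> feasible n T"
    using nth T sched_mono[OF \<delta> z(1)] by (auto simp: feasible_def s_def simp del: upt_Suc)
  have fin: "finite ?S" by (rule finite_subset[of _ "{..n} \<times> {..n}"]) auto
  have less: "loss n \<delta> s < loss n \<delta> t" if t: "t \<in> feasible n T" "t \<noteq> s" for t
  proof -
    define d where "d i = t ! i - ?s i" for i
    have "\<exists>i\<le>n. t ! i \<noteq> ?s i"
    proof (rule ccontr)
      assume "\<not> ?thesis"
      then have "t = s" using t by (intro nth_equalityI) (auto simp: feasible_def s_def simp del: upt_Suc)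
      then show False using t by simp
    qed
    then obtain k where k: "k \<le> n" "t ! k \<noteq> ?s k" by auto
    have t0: "t ! 0 = 0" using t by (simp add: feasible_def)
    then have "k > 0" using k by (cases k) auto
    have "(\<Sum>i\<le>n. d i * (left_sum \<delta> ?s i - right_sum n \<delta> ?s i)) \<le> 0"
      unfolding d_def using sched_stationary[OF \<delta> z T t(1)] by (intro sum_nonpos) auto
    then have "0 \<le> ln \<delta> * (\<Sum>(j, i) \<in> ?S. \<delta> powr (?s i - ?s j) * (d i - d j))"
      unfolding sum_pairs_eq using \<delta> by (intro mult_nonpos_nonpos) auto
    moreover have "loss n \<delta> s = (\<Sum>(j, i) \<in> ?S. \<delta> powr (?s i - ?s j))"
      unfolding loss_def by (intro sum.cong) (auto simp: nth)
    ultimately have "loss n \<delta> s \<le> (\<Sum>(j, i) \<in> ?S. \<delta> powr (?s i - ?s j))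
        + ln \<delta> * (\<Sum>(j, i) \<in> ?S. \<delta> powr (?s i - ?s j) * (d i - d j))"
      by linarith
    also have "\<dots> = (\<Sum>(j, i) \<in> ?S. \<delta> powr (?s i - ?s j)
        + ln \<delta> * (\<delta> powr (?s i - ?s j) * ((t ! i - t ! j) - (?s i - ?s j))))"
      unfolding sum_distrib_left sum.distrib[symmetric]
      by (intro sum.cong refl) (auto simp: d_def algebra_simps)
    also have "\<dots> < loss n \<delta> t"
      unfolding loss_def
    proof (rule sum_strict_mono_ex1[OF fin])
      show "\<exists>x\<in>?S. (case x of (j, i) \<Rightarrow> \<delta> powr (?s i - ?s j)
          + ln \<delta> * (\<delta> powr (?s i - ?s j) * ((t ! i - t ! j) - (?s i - ?s j))))
          < (case x of (j, i) \<Rightarrow> \<delta> powr (t ! i - t ! j))"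
        using powr_tangent(2)[of \<delta> "?s k - ?s 0" "t ! k - t ! 0"] k \<open>k > 0\<close> \<delta> t0
        by (intro bexI[of _ "(0, k)"]) auto
    qed (use powr_tangent(1) \<delta> in auto)
    finally show ?thesis .
  qed
  have "optimal_schedule n \<delta> T = s"
    unfolding optimal_schedule_def
  proof (rule the_equality)
    show "is_arg_min (loss n \<delta>) (\<lambda>t. t \<in> feasible n T) s"
      using feas less by (metis is_arg_min_def less_asym less_irrefl)
    show "t = s" if "is_arg_min (loss n \<delta>) (\<lambda>t. t \<in> feasible n T) t" for t
      using that feas less unfolding is_arg_min_def by blast
  qed
  then show ?thesis by (simp add: s_def)
qed

definition wp :: "com \<Rightarrow> (state \<Rightarrow> bool) \<Rightarrow> state \<Rightarrow> bool" where
  "wp c Q s \<longleftrightarrow> (\<exists>s'. exec c s s' \<and> Q s')"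

lemma wp_Skip [simp]: "wp Skip Q s \<longleftrightarrow> Q s"
  by (auto simp: wp_def intro: exec.Skip elim: SkipE)

lemma wp_NStore [simp]:
  "wp (NStore a e) Q s \<longleftrightarrow> Q (s\<lparr>nmem := (nmem s)(nval a s := nval e s)\<rparr>)"
  by (auto simp: wp_def intro: exec.NStore elim: NStoreE)

lemma wp_RStore [simp]:
  "wp (RStore a e) Q s \<longleftrightarrow> Q (s\<lparr>rmem := (rmem s)(nval a s := rval e s)\<rparr>)"
  by (auto simp: wp_def intro: exec.RStore elim: RStoreE)

lemma wp_Seq [simp]: "wp (Seq c d) Q = wp c (wp d Q)"
  unfolding wp_def fun_eq_iff by (blast intro: exec.Seq elim: SeqE)

lemma wp_Cond [simp]: "wp (Cond b c d) Q s \<longleftrightarrow> (if bval b s then wp c Q s else wp d Q s)"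
  by (auto simp: wp_def intro: exec.CondTrue exec.CondFalse elim: CondE)

lemma wp_mono: "wp c P s \<Longrightarrow> (\<And>s'. P s' \<Longrightarrow> Q s') \<Longrightarrow> wp c Q s"
  by (auto simp: wp_def)

lemma wp_While:
  assumes "I (v::nat) s"
    and step: "\<And>v s. I v s \<Longrightarrow> bval b s \<Longrightarrow> wp c (\<lambda>s'. \<exists>w<v. I w s') s"
    and post: "\<And>v s. I v s \<Longrightarrow> \<not> bval b s \<Longrightarrow> Q s"
  shows "wp (While b c) Q s"
  using assms(1)
proof (induction v arbitrary: s rule: less_induct)
  case (less v)
  show ?case
  proof (cases "bval b s")
    case True
    with step[OF less.prems] obtain s' w where s': "exec c s s'" "w < v" "I w s'"
      by (auto simp: wp_def)
    with less.IH obtain s'' where "exec (While b c) s' s''" "Q s''" unfolding wp_def by blast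
    with True s' show ?thesis unfolding wp_def by (blast intro: exec.WhileTrue)
  next
    case False
    with post[OF less.prems] show ?thesis unfolding wp_def by (blast intro: exec.WhileFalse)
  qed
qed

lemma state_update_commute: "s\<lparr>rmem := r, nmem := f\<rparr> = s\<lparr>nmem := f, rmem := r\<rparr>"
  by simp

notation Seq (infixr ";;" 60)

abbreviation nvar :: "nat \<Rightarrow> nexp" where
  "nvar k \<equiv> NLoad (NConst k)"

text \<open>
  Natural cells: \<open>0\<close> holds \<open>n\<close>, \<open>1\<close> holds \<open>M\<close>, \<open>2\<close> the current point \<open>i\<close>, \<open>3\<close> the rounded exponent \<open>p\<close>,
  \<open>4\<close> a loop counter, \<open>5\<close> the number \<open>min i (n + 1 - i)\<close>. Real cells \<open>0, \<dots>, n\<close> are reserved for the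
  output, so the inputs are first moved to work cells: \<open>n + 1\<close> holds \<open>\<delta>\<close>, \<open>n + 2\<close> holds \<open>T\<close>,
  \<open>n + 3\<close> holds \<open>\<rho>\<close>, \<open>n + 4\<close> holds \<open>z\<close>, \<open>n + 5\<close> the \<open>M\<close>-th power of the product of the first \<open>i\<close>
  gap ratios, \<open>n + 6\<close> holds \<open>\<delta> ^ p\<close> and \<open>n + 7\<close> the current gap ratio.
\<close>

abbreviation waddr :: "nat \<Rightarrow> nexp" where
  "waddr k \<equiv> NAdd (nvar 0) (NConst k)"

abbreviation rvar :: "nat \<Rightarrow> rexp" where
  "rvar k \<equiv> RLoad (waddr k)"

abbreviation rone :: rexp where
  "rone \<equiv> ROfNat (NConst 1)"

definition ratio_com :: com where
  "ratio_com =
    Cond (NLess (nvar 2) (NSub (waddr 1) (nvar 2)))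
      (NStore (NConst 5) (nvar 2)) (NStore (NConst 5) (NSub (waddr 1) (nvar 2))) ;;
    Cond (RLess (ROfNat (nvar 5)) (RAdd (rvar 4) rone))
      (RStore (waddr 7) (RDiv (rvar 4) (ROfNat (nvar 5))))
      (RStore (waddr 7) (RDiv (rvar 4) (RAdd (rvar 4) rone))) ;;
    Cond (RLess rone (rvar 7)) (RStore (waddr 7) rone) Skip"

definition power_com :: com where
  "power_com =
    NStore (NConst 4) (NConst 0) ;;
    While (NLess (nvar 4) (nvar 1))
      (RStore (waddr 5) (RMult (rvar 5) (rvar 7)) ;;
       NStore (NConst 4) (NAdd (nvar 4) (NConst 1)))"

definition floor_com :: com where
  "floor_com =
    While (BNot (RLess (RMult (rvar 6) (rvar 1)) (rvar 5)))
      (RStore (waddr 6) (RMult (rvar 6) (rvar 1)) ;;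
       NStore (NConst 3) (NAdd (nvar 3) (NConst 1)))"

definition output_com :: com where
  "output_com =
    Cond (RLess (RDiv (ROfNat (nvar 3)) (ROfNat (nvar 1))) (rvar 2))
      (RStore (nvar 2) (RDiv (ROfNat (nvar 3)) (ROfNat (nvar 1))))
      (RStore (nvar 2) (rvar 2))"

definition pass_com :: com where
  "pass_com =
    RStore (waddr 5) rone ;; RStore (waddr 6) rone ;;
    NStore (NConst 3) (NConst 0) ;; NStore (NConst 2) (NConst 0) ;;
    While (NLess (nvar 2) (nvar 0))
      (NStore (NConst 2) (NAdd (nvar 2) (NConst 1)) ;;
       ratio_com ;; power_com ;; floor_com ;; output_com)"

definition init_com :: com where
  "init_com =
    RStore (waddr 1) (RLoad (NConst 0)) ;; RStore (waddr 2) (RLoad (NConst 1)) ;;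
    RStore (NConst 0) (ROfNat (NConst 0)) ;; RStore (NConst 1) (ROfNat (NConst 0)) ;;
    NStore (NConst 1) (NConst 2) ;; NStore (NConst 4) (NConst 0) ;;
    While (NLess (nvar 4) (nvar 0))
      (NStore (NConst 1) (NMult (nvar 1) (NConst 2)) ;;
       NStore (NConst 4) (NAdd (nvar 4) (NConst 1))) ;;
    RStore (waddr 3)
      (RSub rone (RDiv (RSub rone (rvar 1)) (ROfNat (NMult (nvar 0) (nvar 1))))) ;;
    RStore (waddr 4) (ROfNat (nvar 0))"

definition schedule_com :: com where
  "schedule_com =
    init_com ;;
    While (RLess (RLoad (nvar 0)) (rvar 2))
      (RStore (waddr 4) (RMult (rvar 4) (rvar 3)) ;; pass_com)"

lemma wp_ratio_com:
  assumes "nmem s 0 = n" "nmem s 2 = i" "rmem s (n + 4) = z" "0 < z" "1 \<le> i" "i \<le> n"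
    and "Q (s\<lparr>nmem := (nmem s)(5 := min i (n + 1 - i)),
      rmem := (rmem s)(n + 7 := gap_ratio n z i)\<rparr>)"
  shows "wp ratio_com Q s"
proof -
  define e where "e = min i (n + 1 - i)"
  have e: "(if i < n + 1 - i then i else n + 1 - i) = e" by (auto simp: e_def)
  have g: "gap_ratio n z i = min 1 (if real e < z + 1 then z / real e else z / (z + 1))"
    by (simp add: gap_ratio_def e_def)
  define b where "b = (if real e < z + 1 then z / real e else z / (z + 1))"
  have 1: "wp (Cond (NLess (nvar 2) (NSub (waddr 1) (nvar 2)))
      (NStore (NConst 5) (nvar 2)) (NStore (NConst 5) (NSub (waddr 1) (nvar 2)))) R s"
    if "R (s\<lparr>nmem := (nmem s)(5 := e)\<rparr>)" for R
    using that assms(1,2) e by (auto split: if_splits)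
  have 2: "wp (Cond (RLess (ROfNat (nvar 5)) (RAdd (rvar 4) rone))
      (RStore (waddr 7) (RDiv (rvar 4) (ROfNat (nvar 5))))
      (RStore (waddr 7) (RDiv (rvar 4) (RAdd (rvar 4) rone)))) R (s\<lparr>nmem := (nmem s)(5 := e)\<rparr>)"
    if "R (s\<lparr>nmem := (nmem s)(5 := e), rmem := (rmem s)(n + 7 := b)\<rparr>)" for R
    using that assms(1,3) by (auto simp: b_def split: if_splits)
  have 3: "wp (Cond (RLess rone (rvar 7)) (RStore (waddr 7) rone) Skip) Q
      (s\<lparr>nmem := (nmem s)(5 := e), rmem := (rmem s)(n + 7 := b)\<rparr>)"
    using assms(1) assms(7) unfolding g b_def[symmetric] e_def[symmetric]
    by (auto simp: min_def split: if_splits)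
  show ?thesis unfolding ratio_com_def wp_Seq by (intro 1 2 3)
qed

lemma wp_power_com:
  assumes "nmem s 0 = n"
    and "Q (s\<lparr>nmem := (nmem s)(4 := nmem s 1),
      rmem := (rmem s)(n + 5 := rmem s (n + 5) * rmem s (n + 7) ^ nmem s 1)\<rparr>)"
  shows "wp power_com Q s"
proof -
  let ?t = "\<lambda>j. s\<lparr>nmem := (nmem s)(4 := j),
      rmem := (rmem s)(n + 5 := rmem s (n + 5) * rmem s (n + 7) ^ j)\<rparr>"
  define I where "I v s' \<longleftrightarrow> (\<exists>j. j + v = nmem s 1 \<and> s' = ?t j)" for v s'
  have "wp (While (NLess (nvar 4) (nvar 1))
      (RStore (waddr 5) (RMult (rvar 5) (rvar 7)) ;;
       NStore (NConst 4) (NAdd (nvar 4) (NConst 1)))) Q (?t 0)"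
  proof (rule wp_While[where I = I and v = "nmem s 1"])
    show "I (nmem s 1) (?t 0)" by (auto simp: I_def)
  next
    fix v s' assume I: "I v s'" and b: "bval (NLess (nvar 4) (nvar 1)) s'"
    from I obtain j where j: "j + v = nmem s 1" "s' = ?t j" by (auto simp: I_def)
    with b have "j < nmem s 1" by simp
    with j obtain w where w: "v = Suc w" by (cases v) auto
    with j have "I w (?t (Suc j))" unfolding I_def by (intro exI[of _ "Suc j"]) simp
    then show "wp (RStore (waddr 5) (RMult (rvar 5) (rvar 7)) ;;
       NStore (NConst 4) (NAdd (nvar 4) (NConst 1))) (\<lambda>s''. \<exists>w<v. I w s'') s'"
      using assms(1) j w by (auto simp: state_update_commute mult_ac intro!: exI[of _ w])
  next
    fix v s' assume I: "I v s'" and b: "\<not> bval (NLess (nvar 4) (nvar 1)) s'"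
    from I obtain j where j: "j + v = nmem s 1" "s' = ?t j" by (auto simp: I_def)
    with b have "j = nmem s 1" by simp
    with j assms(2) show "Q s'" by simp
  qed
  then show ?thesis by (simp add: power_com_def)
qed

lemma wp_floor_com:
  assumes n: "nmem s 0 = n" and \<delta>: "0 < \<delta>" "\<delta> < 1" "rmem s (n + 1) = \<delta>"
    and P: "rmem s (n + 5) = P" "0 < P" "P \<le> \<delta> ^ p"
    and p: "nmem s 3 = p" "rmem s (n + 6) = \<delta> ^ p"
    and Q: "\<And>k. \<delta> ^ Suc k < P \<Longrightarrow> P \<le> \<delta> ^ k \<Longrightarrow>
      Q (s\<lparr>nmem := (nmem s)(3 := k), rmem := (rmem s)(n + 6 := \<delta> ^ k)\<rparr>)"
  shows "wp floor_com Q s"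
proof -
  let ?t = "\<lambda>k. s\<lparr>nmem := (nmem s)(3 := k), rmem := (rmem s)(n + 6 := \<delta> ^ k)\<rparr>"
  define I where "I v s' \<longleftrightarrow> (\<exists>k. P \<le> \<delta> ^ k \<and> \<delta> ^ (k + v) < P \<and> s' = ?t k)" for v s'
  obtain m where m: "\<delta> ^ m < P" using real_arch_pow_inv[OF P(2) \<delta>(2)] by auto
  have "\<delta> ^ (p + m) \<le> \<delta> ^ m" using \<delta> by (intro power_decreasing) auto
  then have "I m s" unfolding I_def using P p m
    by (intro exI[of _ p]) (auto simp: fun_upd_idem)
  then show ?thesis unfolding floor_com_def
  proof (rule wp_While[where I = I])
    fix v s' assume I: "I v s'" and b: "bval (BNot (RLess (RMult (rvar 6) (rvar 1)) (rvar 5))) s'"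
    from I obtain k where k: "P \<le> \<delta> ^ k" "\<delta> ^ (k + v) < P" "s' = ?t k" by (auto simp: I_def)
    then obtain w where w: "v = Suc w" by (cases v) auto
    with b k n \<delta> P have "I w (?t (Suc k))"
      by (auto simp: I_def mult.commute intro!: exI[of _ "Suc k"])
    then show "wp (RStore (waddr 6) (RMult (rvar 6) (rvar 1)) ;;
       NStore (NConst 3) (NAdd (nvar 3) (NConst 1))) (\<lambda>s''. \<exists>w<v. I w s'') s'"
      using n \<delta> k w by (auto simp: state_update_commute mult_ac intro!: exI[of _ w])
  next
    fix v s' assume I: "I v s'" and b: "\<not> bval (BNot (RLess (RMult (rvar 6) (rvar 1)) (rvar 5))) s'"
    from I obtain k where k: "P \<le> \<delta> ^ k" "s' = ?t k" by (auto simp: I_def)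
    with b n \<delta> P have "\<delta> ^ Suc k < P" by (simp add: mult.commute)
    with Q k show "Q s'" by simp
  qed
qed

definition approx :: "real \<Rightarrow> nat \<Rightarrow> real \<Rightarrow> nat \<Rightarrow> real \<Rightarrow> nat \<Rightarrow> real" where
  "approx T M \<delta> n z i = min T (real_of_int \<lfloor>real M * sched \<delta> n z i\<rfloor> / real M)"

definition env :: "nat \<Rightarrow> nat \<Rightarrow> real \<Rightarrow> real \<Rightarrow> real \<Rightarrow> real \<Rightarrow> state \<Rightarrow> bool" where
  "env n M \<delta> T \<rho> z s \<longleftrightarrow> nmem s 0 = n \<and> nmem s 1 = M \<and> rmem s (n + 1) = \<delta> \<and>
     rmem s (n + 2) = T \<and> rmem s (n + 3) = \<rho> \<and> rmem s (n + 4) = z"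

lemma floor_eq_powr:
  fixes \<delta> x :: real
  assumes "0 < \<delta>" "\<delta> < 1" "\<delta> ^ Suc k < \<delta> powr x" "\<delta> powr x \<le> \<delta> ^ k"
  shows "\<lfloor>x\<rfloor> = int k"
proof -
  have "\<delta> powr real (Suc k) < \<delta> powr x" "\<delta> powr x \<le> \<delta> powr real k"
    using assms by (simp_all only: powr_realpow)
  then have "x < real (Suc k)" "real k \<le> x"
    using assms(1,2) powr_mono'[of "real (Suc k)" x \<delta>] powr_less_mono'[of \<delta> x "real k"] by force+
  then show ?thesis by (simp add: floor_eq_iff)
qed

lemma wp_pass_com:
  assumes env: "env n M \<delta> T \<rho> z s" and \<delta>: "0 < \<delta>" "\<delta> < 1" and T: "0 < T" and z: "0 < z"
    and zero: "rmem s 0 = 0"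
  shows "wp pass_com (\<lambda>s'. env n M \<delta> T \<rho> z s' \<and> (\<forall>l\<le>n. rmem s' l = approx T M \<delta> n z l)) s"
    (is "wp _ ?Q s")
proof -
  define I where "I v s' \<longleftrightarrow> env n M \<delta> T \<rho> z s' \<and> nmem s' 2 + v = n \<and>
      rmem s' (n + 5) = \<delta> powr (real M * sched \<delta> n z (nmem s' 2)) \<and>
      rmem s' (n + 5) \<le> \<delta> ^ nmem s' 3 \<and> rmem s' (n + 6) = \<delta> ^ nmem s' 3 \<and>
      (\<forall>l\<le>nmem s' 2. rmem s' l = approx T M \<delta> n z l)" for v s'
  let ?t = "s\<lparr>nmem := (nmem s)(3 := 0, 2 := 0), rmem := (rmem s)(n + 5 := 1, n + 6 := 1)\<rparr>"
  let ?body = "NStore (NConst 2) (NAdd (nvar 2) (NConst 1)) ;;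
       ratio_com ;; power_com ;; floor_com ;; output_com"
  have "wp (While (NLess (nvar 2) (nvar 0)) ?body) ?Q ?t"
  proof (rule wp_While[where I = I and v = n])
    show "I n ?t" using env zero T \<delta> by (auto simp: I_def env_def approx_def)
  next
    fix v s' assume I: "I v s'" and "bval (NLess (nvar 2) (nvar 0)) s'"
    then have "v \<noteq> 0" and i: "nmem s' 2 < n" by (auto simp: I_def env_def)
    then obtain w where w: "v = Suc w" by (cases v) auto
    define i where "i = nmem s' 2"
    have step: "\<delta> powr (real M * sched \<delta> n z (Suc i))
        = \<delta> powr (real M * sched \<delta> n z i) * gap_ratio n z (Suc i) ^ M"
    proof -
      have g: "gap_ratio n z (Suc i) > 0" using gap_ratio_pos z i by (simp add: i_def)
      have "gap_ratio n z (Suc i) ^ M = gap_ratio n z (Suc i) powr real M"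
        using g by (simp add: powr_realpow)
      also have "\<dots> = (\<delta> powr log \<delta> (gap_ratio n z (Suc i))) powr real M"
        using g \<delta> by simp
      finally show ?thesis
        by (simp add: sched_Suc distrib_left powr_add powr_powr mult.commute)
    qed
    have le: "\<delta> powr (real M * sched \<delta> n z (Suc i)) \<le> \<delta> powr (real M * sched \<delta> n z i)"
      unfolding step using gap_ratio_le_1[of n z "Suc i"] gap_ratio_pos[of z "Suc i" n] z i
      by (intro mult_left_le power_le_one) (auto simp: i_def)
    have env': "nmem s' 0 = n" "nmem s' 1 = M" "rmem s' (n + 1) = \<delta>" "rmem s' (n + 2) = T"
        "rmem s' (n + 3) = \<rho>" "rmem s' (n + 4) = z"
      and I': "i + v = n" "rmem s' (n + 5) = \<delta> powr (real M * sched \<delta> n z i)"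
        "\<delta> powr (real M * sched \<delta> n z i) \<le> \<delta> ^ nmem s' 3" "rmem s' (n + 6) = \<delta> ^ nmem s' 3"
        "\<And>l. l \<le> i \<Longrightarrow> rmem s' l = approx T M \<delta> n z l"
      using I by (auto simp: I_def env_def i_def)
    let ?R = "\<lambda>s''. \<exists>w<v. I w s''" and ?P = "\<delta> powr (real M * sched \<delta> n z (Suc i))"
    let ?s1 = "s'\<lparr>nmem := (nmem s')(2 := Suc i)\<rparr>"
    let ?s2 = "?s1\<lparr>nmem := (nmem ?s1)(5 := min (Suc i) (n + 1 - Suc i)),
      rmem := (rmem ?s1)(n + 7 := gap_ratio n z (Suc i))\<rparr>"
    let ?s3 = "?s2\<lparr>nmem := (nmem ?s2)(4 := M), rmem := (rmem ?s2)(n + 5 := ?P)\<rparr>"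
    let ?s4 = "\<lambda>k. ?s3\<lparr>nmem := (nmem ?s3)(3 := k), rmem := (rmem ?s3)(n + 6 := \<delta> ^ k)\<rparr>"
    have "wp output_com ?R (?s4 k)" if k: "\<delta> ^ Suc k < ?P" "?P \<le> \<delta> ^ k" for k
    proof -
      let ?s5 = "(?s4 k)\<lparr>rmem := (rmem (?s4 k))(Suc i := approx T M \<delta> n z (Suc i))\<rparr>"
      have "I w ?s5"
        unfolding I_def env_def using env' I' i w k by (auto simp: i_def le_Suc_eq)
      then have "?R ?s5" using w by blast
      moreover have "approx T M \<delta> n z (Suc i) = (if real k / real M < T then real k / real M else T)"
        using floor_eq_powr[OF \<delta> k] by (simp add: approx_def)
      ultimately show ?thesis using env' by (simp add: output_com_def split: if_splits)
    qed
    then have "wp floor_com (wp output_com ?R) ?s3"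
      using env' I' \<delta> le by (intro wp_floor_com[where n = n and \<delta> = \<delta> and P = ?P and p = "nmem s' 3"]) auto
    then have "wp power_com (wp floor_com (wp output_com ?R)) ?s2"
      using env' I' step by (intro wp_power_com[where n = n]) auto
    then have "wp ratio_com (wp power_com (wp floor_com (wp output_com ?R))) ?s1"
      using env' z i by (intro wp_ratio_com[where n = n and i = "Suc i" and z = z]) (auto simp: i_def)
    then show "wp ?body ?R s'" by (simp add: i_def)
  next
    fix v s' assume "I v s'" "\<not> bval (NLess (nvar 2) (nvar 0)) s'"
    then show "?Q s'" by (auto simp: I_def env_def)
  qed
  then show ?thesis using env by (simp add: pass_com_def env_def state_update_commute)
qed

lemma wp_init_com:
  assumes n: "n \<ge> 1"
    and Q: "\<And>s. env n (2 ^ Suc n) \<delta> T (1 - (1 - \<delta>) / (real n * 2 ^ Suc n)) (real n) s \<Longrightarrow>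
      (\<forall>l\<le>n. rmem s l = 0) \<Longrightarrow> Q s"
  shows "wp init_com Q (initial_state n \<delta> T)"
proof -
  let ?s = "initial_state n \<delta> T"
  let ?t = "\<lambda>j. ?s\<lparr>nmem := (nmem ?s)(1 := 2 ^ Suc j, 4 := j),
      rmem := (rmem ?s)(n + 1 := \<delta>, n + 2 := T, 0 := 0, 1 := 0)\<rparr>"
  let ?rest = "RStore (waddr 3)
      (RSub rone (RDiv (RSub rone (rvar 1)) (ROfNat (NMult (nvar 0) (nvar 1))))) ;;
    RStore (waddr 4) (ROfNat (nvar 0))"
  define I where "I v s' \<longleftrightarrow> (\<exists>j. j + v = n \<and> s' = ?t j)" for v s'
  have "wp (While (NLess (nvar 4) (nvar 0))
      (NStore (NConst 1) (NMult (nvar 1) (NConst 2)) ;;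
       NStore (NConst 4) (NAdd (nvar 4) (NConst 1)))) (wp ?rest Q) (?t 0)"
  proof (rule wp_While[where I = I and v = n])
    show "I n (?t 0)" by (auto simp: I_def)
  next
    fix v s' assume I: "I v s'" and b: "bval (NLess (nvar 4) (nvar 0)) s'"
    from I obtain j where j: "j + v = n" "s' = ?t j" by (auto simp: I_def)
    with b have "j < n" by (simp add: initial_state_def)
    with j obtain w where w: "v = Suc w" by (cases v) auto
    with j have "I w (?t (Suc j))" unfolding I_def by (intro exI[of _ "Suc j"]) auto
    then show "wp (NStore (NConst 1) (NMult (nvar 1) (NConst 2)) ;;
       NStore (NConst 4) (NAdd (nvar 4) (NConst 1))) (\<lambda>s''. \<exists>w<v. I w s'') s'"
      using j w by (auto simp: mult_ac fun_upd_twist initial_state_def intro!: exI[of _ w])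
  next
    fix v s' assume "I v s'" "\<not> bval (NLess (nvar 4) (nvar 0)) s'"
    then have "s' = ?t n" by (auto simp: I_def initial_state_def)
    then show "wp ?rest Q s'" using n by (auto simp: env_def initial_state_def intro!: Q)
  qed
  then show ?thesis using n by (simp add: init_com_def initial_state_def)
qed

lemma sched_coarse_step:
  assumes "0 < \<delta>" "\<delta> < 1" "0 < z" "n \<ge> 1" "M \<ge> 1"
    and \<rho>: "\<rho> = 1 - (1 - \<delta>) / (real n * real M)"
  shows "0 < \<rho>" "\<rho> < 1" "sched \<delta> n (z * \<rho>) n \<le> sched \<delta> n z n + 1 / real M"
proof -
  define K where "K = n * M"
  have K: "K \<ge> 1" using assms by (simp add: K_def)
  have r: "\<rho> = 1 + - ((1 - \<delta>) / real K)"
    using \<rho> by (simp add: K_def)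
  have "(1 - \<delta>) / real K < 1" using assms K by (simp add: field_simps)
  then show 0: "0 < \<rho>" using r by simp
  show 1: "\<rho> < 1" using r assms K by simp
  have "1 + real K * - ((1 - \<delta>) / real K) \<le> \<rho> ^ K"
    unfolding r using K 0 r by (intro Bernoulli_inequality) auto
  then have "\<delta> \<le> \<rho> ^ K" using K by simp
  then have "log \<delta> (\<rho> ^ K) \<le> log \<delta> \<delta>" using assms by (intro log_base_less_1) auto
  then have "real K * log \<delta> \<rho> \<le> 1" using assms(1,2) 0 by (simp add: log_nat_power)
  then have "real n * log \<delta> \<rho> \<le> 1 / real M"
    using assms(5) by (simp add: K_def pos_le_divide_eq mult_ac)
  then show "sched \<delta> n (z * \<rho>) n \<le> sched \<delta> n z n + 1 / real M"
    using sched_scale[of \<delta> z \<rho> n] assms 0 1 by (simp add: mult.commute)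
qed

lemma wp_schedule_com:
  assumes n: "n \<ge> 1" and \<delta>: "0 < \<delta>" "\<delta> < 1" and T: "0 < T" and M: "M = 2 ^ Suc n"
  shows "wp schedule_com (\<lambda>s. \<exists>z>0. T \<le> sched \<delta> n z n \<and> sched \<delta> n z n < T + 2 / real M \<and>
    (\<forall>l\<le>n. rmem s l = approx T M \<delta> n z l) \<and> rmem s n = T) (initial_state n \<delta> T)"
    (is "wp _ ?Q _")
proof -
  have M1: "M \<ge> 1" by (simp add: M)
  define \<rho> where "\<rho> = 1 - (1 - \<delta>) / (real n * real M)"
  note coarse = sched_coarse_step[OF \<delta> _ n M1 \<rho>_def]
  have \<rho>: "0 < \<rho>" "\<rho> < 1" using coarse[of 1] by auto
  define I where "I v s \<longleftrightarrow> (\<exists>z>0. env n M \<delta> T \<rho> z s \<and> sched \<delta> n z n < T + 2 / real M \<and>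
      (\<forall>l\<le>n. rmem s l = approx T M \<delta> n z l) \<and> z * \<rho> ^ v \<le> \<delta> powr (T + 1 / real M))" for v s
  show ?thesis unfolding schedule_com_def wp_Seq
  proof (rule wp_init_com[OF n])
    fix s assume env: "env n (2 ^ Suc n) \<delta> T (1 - (1 - \<delta>) / (real n * 2 ^ Suc n)) (real n) s"
      and zero: "\<forall>l\<le>n. rmem s l = 0"
    have env': "env n M \<delta> T \<rho> (real n) s" using env by (simp add: M \<rho>_def)
    have s0: "sched \<delta> n (real n) l = 0" if "l \<le> n" for l
      using that n by (intro sched_eq_0) auto
    have "\<delta> powr (T + 1 / real M) / real n > 0" using \<delta> n by simp
    then obtain v where v: "\<rho> ^ v < \<delta> powr (T + 1 / real M) / real n"
      using real_arch_pow_inv \<rho> by blast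
    have "I v s" unfolding I_def
      using env' zero s0 v n T M1 by (intro exI[of _ "real n"])
        (auto simp: approx_def add_pos_pos pos_less_divide_eq mult.commute)
    then show "wp (While (RLess (RLoad (nvar 0)) (rvar 2))
      (RStore (waddr 4) (RMult (rvar 4) (rvar 3)) ;; pass_com)) ?Q s"
    proof (rule wp_While[where I = I])
      fix v s assume "I v s" and b: "bval (RLess (RLoad (nvar 0)) (rvar 2)) s"
      then obtain z where z: "z > 0" "env n M \<delta> T \<rho> z s"
          "\<forall>l\<le>n. rmem s l = approx T M \<delta> n z l" "z * \<rho> ^ v \<le> \<delta> powr (T + 1 / real M)"
        by (auto simp: I_def)
      have "approx T M \<delta> n z n < T" using b z by (auto simp: env_def)
      then have "real_of_int \<lfloor>real M * sched \<delta> n z n\<rfloor> < T * real M"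
        using M1 by (auto simp: approx_def field_simps min_def split: if_splits)
      then have "real M * sched \<delta> n z n < T * real M + 1" by linarith
      then have less: "sched \<delta> n z n < T + 1 / real M" using M1 by (simp add: field_simps)
      have "v \<noteq> 0"
      proof
        assume "v = 0"
        then have "T + 1 / real M \<le> sched \<delta> n z n" using z n \<delta> by (intro sched_last_ge) auto
        then show False using less by simp
      qed
      then have v: "v - 1 < v" "z * \<rho> * \<rho> ^ (v - 1) = z * \<rho> ^ v" by (cases v; simp)+
      have "sched \<delta> n (z * \<rho>) n \<le> sched \<delta> n z n + 1 / real M" using coarse(3)[OF z(1)] .
      then have less2: "sched \<delta> n (z * \<rho>) n < T + 2 / real M" using less by simp
      let ?s = "s\<lparr>rmem := (rmem s)(n + 4 := z * \<rho>)\<rparr>"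
      have z0: "rmem s 0 = 0" using z T by (simp add: approx_def)
      have "wp pass_com (\<lambda>s'. env n M \<delta> T \<rho> (z * \<rho>) s' \<and>
          (\<forall>l\<le>n. rmem s' l = approx T M \<delta> n (z * \<rho>) l)) ?s"
        using z z0 \<rho> \<delta> T by (intro wp_pass_com) (auto simp: env_def)
      then have "wp pass_com (\<lambda>s'. \<exists>w<v. I w s') ?s"
        by (rule wp_mono) (use v z \<rho> less2 in 
          \<open>auto simp: I_def mult.assoc intro!: exI[of _ "v - 1"] exI[of _ "z * \<rho>"]\<close>)
      then show "wp (RStore (waddr 4) (RMult (rvar 4) (rvar 3)) ;; pass_com) (\<lambda>s'. \<exists>w<v. I w s') s"
        using z by (simp add: env_def)
    next
      fix v s assume "I v s" and b: "\<not> bval (RLess (RLoad (nvar 0)) (rvar 2)) s"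
      then obtain z where z: "z > 0" "env n M \<delta> T \<rho> z s" "sched \<delta> n z n < T + 2 / real M"
          "\<forall>l\<le>n. rmem s l = approx T M \<delta> n z l"
        by (auto simp: I_def)
      have "T \<le> approx T M \<delta> n z n" using b z by (auto simp: env_def)
      then have eq: "approx T M \<delta> n z n = T"
        and "T * real M \<le> real_of_int \<lfloor>real M * sched \<delta> n z n\<rfloor>"
        using M1 by (auto simp: approx_def field_simps)
      then have "T * real M \<le> real M * sched \<delta> n z n" by linarith
      then have "T \<le> sched \<delta> n z n" using M1 by (simp add: field_simps)
      then show "?Q s" using z eq by auto
    qed
  qed
qed

theorem theorem4:
  "\<exists>P. \<forall>(n::nat) (\<delta>::real) (T::real).
     n \<ge> 1 \<longrightarrow> T > 0 \<longrightarrow> 0 < \<delta> \<longrightarrow> \<delta> < 1 \<longrightarrow>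
     (\<exists>t. outputs P n \<delta> T t \<and> t \<in> feasible n T \<and>
          (\<forall>i\<le>n. optimal_schedule n \<delta> T ! i - 1 / 2 ^ n \<le> t ! i \<and>
                 t ! i \<le> optimal_schedule n \<delta> T ! i + 1 / 2 ^ n))"
proof (intro exI[of _ schedule_com] allI impI)
  fix n :: nat and \<delta> T :: real
  assume n: "n \<ge> 1" and T: "T > 0" and \<delta>: "0 < \<delta>" "\<delta> < 1"
  define M :: nat where "M = 2 ^ Suc n"
  have M: "M \<ge> 1" "2 / real M = 1 / 2 ^ n" "1 / real M \<le> 1 / 2 ^ n"
    by (simp_all add: M_def field_simps)
  obtain s z where s: "exec schedule_com (initial_state n \<delta> T) s" and z: "z > 0"
    and upper: "T \<le> sched \<delta> n z n" "sched \<delta> n z n < T + 2 / real M"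
    and out: "\<And>l. l \<le> n \<Longrightarrow> rmem s l = approx T M \<delta> n z l" and last: "rmem s n = T"
    using wp_schedule_com[OF n \<delta> T M_def] unfolding wp_def by blast
  obtain z' where z': "0 < z'" "z' \<le> real ((n + 1) div 2)" "sched \<delta> n z' n = T"
    using sched_surj[OF \<delta> T n] .
  note opt = optimal_schedule_eq_sched[OF \<delta> z']
  define t where "t = map (rmem s) [0..<n + 1]"
  have nth: "t ! i = approx T M \<delta> n z i" if "i \<le> n" for i
    using that out by (simp add: t_def del: upt_Suc)
  have mono: "approx T M \<delta> n z i \<le> approx T M \<delta> n z (i + 1)" if "i < n" for i
    unfolding approx_def using sched_mono[OF \<delta> z, of i "i + 1" n] that
    by (intro min.mono order_refl divide_right_mono) (auto intro!: floor_mono mult_left_mono)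
  have "t \<in> feasible n T"
    using nth mono T out last by (auto simp: feasible_def t_def approx_def simp del: upt_Suc)
  moreover have "sched \<delta> n z' i - 1 / 2 ^ n \<le> t ! i \<and> t ! i \<le> sched \<delta> n z' i + 1 / 2 ^ n"
    if i: "i \<le> n" for i
  proof -
    have close: "sched \<delta> n z' i \<le> sched \<delta> n z i \<and> sched \<delta> n z i \<le> sched \<delta> n z' i + 1 / 2 ^ n"
    proof (cases "z \<le> z'")
      case True
      then show ?thesis using sched_diff_bounds[OF \<delta> z True i] upper z' M by simp
    next
      case False
      then show ?thesis using sched_diff_bounds[OF \<delta> z'(1) _ i, of z] upper z' zero_le_power[of 2 n]
        by (auto intro: order_trans)
    qed
    have "sched \<delta> n z' i \<le> T" using sched_mono[OF \<delta> z'(1) i order_refl] z' by simp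
    moreover define f where "f = real_of_int \<lfloor>real M * sched \<delta> n z i\<rfloor>"
    have "f \<le> real M * sched \<delta> n z i" "real M * sched \<delta> n z i < f + 1"
      unfolding f_def by linarith+
    then have "f / real M \<le> sched \<delta> n z i" "sched \<delta> n z i \<le> f / real M + 1 / real M"
      using M by (simp_all add: field_simps)
    moreover have "t ! i = min T (f / real M)" using nth[OF i] by (simp add: approx_def f_def)
    ultimately show ?thesis using close M by linarith
  qed
  ultimately show "\<exists>t. outputs schedule_com n \<delta> T t \<and> t \<in> feasible n T \<and>
      (\<forall>i\<le>n. optimal_schedule n \<delta> T ! i - 1 / 2 ^ n \<le> t ! i \<and>
             t ! i \<le> optimal_schedule n \<delta> T ! i + 1 / 2 ^ n)"
    using s by (intro exI[of _ t]) (auto simp: outputs_def t_def opt simp del: upt_Suc)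
qed

end
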